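(* Let $\mathcal{D}$ be a triangulated category and let $D_1=(D_1^{\leqslant 0},D_1^{\geqslant 1})$ and $D_2=(D_2^{\leqslant 0},D_2^{\geqslant 1})$ be t-structures on $\mathcal{D}$, neither of which is stable, such that $D_1^{\leqslant n_1}\subseteq D_2^{\leqslant 0}\subseteq D_1^{\leqslant n_2}$ for some integers $n_1\leqslant n_2$. Let $H_1$ be the heart of $D_1$, and let $$U^{\leqslant 0}=D_1^{\geqslant n_1+1}\cap D_1^{\leqslant n_2}\cap D_2^{\leqslant 0},\qquad U^{\geqslant 1}=D_1^{\geqslant n_1+1}\cap D_1^{\leqslant n_2}\cap D_2^{\geqslant 1}.$$ Define integers $a$ and $b$ as follows. If there is $i\in\{n_1+1,\dots,n_2\}$ such that $\Sigma^{-j}(H_1)\subseteq U^{\leqslant 0}$ for all $n_1+1\leqslant j\leqslant i$, let $a$ be the largest such $i$; otherwise let $a=n_1$. If there is $i\in\{n_1+1,\dots,n_2\}$ such that $\Sigma^{-j}(H_1)\subseteq U^{\geqslant 1}$ for all $i\leqslant j\leqslant n_2$, let $b$ be the smallest such $i$; otherwise let $b=n_2+1$. Then $$d(D_1,D_2)=b-a-1.$$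
   Context: $\Sigma$ is the translation functor of $\mathcal{D}$. Full subcategories are taken closed under isomorphism. A t-structure $D_1=(D_1^{\leqslant 0},D_1^{\geqslant 1})$ on $\mathcal{D}$ is a pair of full subcategories with: (T1) $\Sigma D_1^{\leqslant 0}\subseteq D_1^{\leqslant 0}$ and $D_1^{\geqslant 1}\subseteq\Sigma D_1^{\geqslant 1}$; (T2) $\mathrm{Hom}_{\mathcal{D}}(D_1^{\leqslant 0},D_1^{\geqslant 1})=0$; (T3) every $X\in\mathcal{D}$ fits in a distinguished triangle $X_0\to X\to X_1\to\Sigma(X_0)$ with $X_0\in D_1^{\leqslant 0}$, $X_1\in D_1^{\geqslant 1}$. For an integer $n$, $D_1^{\leqslant n}=\Sigma^{-n}D_1^{\leqslant 0}$ and $D_1^{\geqslant n}=\Sigma^{-n+1}D_1^{\geqslant 1}$. The heart is $H_1=D_1^{\leqslant 0}\cap D_1^{\geqslant 0}$. The t-structure is stable if $\Sigma(D_1^{\leqslant 0})=D_1^{\leqslant 0}$. The distance $d(D_1,D_2)$ of two t-structures is the smallest natural number $d\geqslant 0$ such that $D_1^{\leqslant m}\subseteq D_2^{\leqslant 0}\subseteq D_1^{\leqslant m+d}$ for some integer $m$; it is $+\infty$ if no such $d$ exists. *)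

theory Defs
  imports "HOL-Algebra.Group" "HOL-Library.Extended_Nat"
begin

text \<open>Every arrow determines its source and target, so distinct hom-sets are disjoint.
  As in HOL-Algebra, only the values of the operations on the carriers matter.\<close>

record ('o, 'm) cat_data =
  Obj :: "'o set"
  Arr :: "'m set"
  src :: "'m \<Rightarrow> 'o"
  tgt :: "'m \<Rightarrow> 'o"
  ident :: "'o \<Rightarrow> 'm"
  cmp :: "'m \<Rightarrow> 'm \<Rightarrow> 'm"  (infixl "\<cdot>\<index>" 70)

definition Hom :: "('o, 'm, 'z) cat_data_scheme \<Rightarrow> 'o \<Rightarrow> 'o \<Rightarrow> 'm set" where
  "Hom C X Y = {f \<in> Arr C. src C f = X \<and> tgt C f = Y}"

locale category =
  fixes C :: "('o, 'm, 'z) cat_data_scheme" (structure)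
  assumes src_closed: "f \<in> Arr C \<Longrightarrow> src C f \<in> Obj C"
    and tgt_closed: "f \<in> Arr C \<Longrightarrow> tgt C f \<in> Obj C"
    and ident_closed: "X \<in> Obj C \<Longrightarrow> ident C X \<in> Hom C X X"
    and cmp_closed: "f \<in> Hom C X Y \<Longrightarrow> g \<in> Hom C Y Z \<Longrightarrow> g \<cdot> f \<in> Hom C X Z"
    and cmp_assoc: "f \<in> Hom C W X \<Longrightarrow> g \<in> Hom C X Y \<Longrightarrow> h \<in> Hom C Y Z \<Longrightarrow>
      (h \<cdot> g) \<cdot> f = h \<cdot> (g \<cdot> f)"
    and cmp_ident_right: "f \<in> Hom C X Y \<Longrightarrow> f \<cdot> ident C X = f"
    and cmp_ident_left: "f \<in> Hom C X Y \<Longrightarrow> ident C Y \<cdot> f = f"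

definition iso_between :: "('o, 'm, 'z) cat_data_scheme \<Rightarrow> 'm \<Rightarrow> 'o \<Rightarrow> 'o \<Rightarrow> bool" where
  "iso_between C f X Y \<longleftrightarrow> f \<in> Hom C X Y \<and>
    (\<exists>g \<in> Hom C Y X. g \<cdot>\<^bsub>C\<^esub> f = ident C X \<and> f \<cdot>\<^bsub>C\<^esub> g = ident C Y)"

definition isomorphic :: "('o, 'm, 'z) cat_data_scheme \<Rightarrow> 'o \<Rightarrow> 'o \<Rightarrow> bool" where
  "isomorphic C X Y \<longleftrightarrow> (\<exists>f. iso_between C f X Y)"

definition zero_object :: "('o, 'm, 'z) cat_data_scheme \<Rightarrow> 'o \<Rightarrow> bool" where
  "zero_object C N \<longleftrightarrow> N \<in> Obj C \<and>
    (\<forall>X \<in> Obj C. (\<exists>!f. f \<in> Hom C X N) \<and> (\<exists>!f. f \<in> Hom C N X))"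

text \<open>A full subcategory closed under isomorphism is given by its set of objects.\<close>

definition strict_full_subcategory ::
    "('o, 'm, 'z) cat_data_scheme \<Rightarrow> 'o set \<Rightarrow> bool" where
  "strict_full_subcategory C A \<longleftrightarrow>
    A \<subseteq> Obj C \<and> (\<forall>X \<in> A. \<forall>Y \<in> Obj C. isomorphic C X Y \<longrightarrow> Y \<in> A)"

record ('o, 'm) additive_data = "('o, 'm) cat_data" +
  hom_add :: "'m \<Rightarrow> 'm \<Rightarrow> 'm"  (infixl "\<oplus>\<index>" 65)
  hom_zero :: "'o \<Rightarrow> 'o \<Rightarrow> 'm"

definition Hom_group :: "('o, 'm, 'z) additive_data_scheme \<Rightarrow> 'o \<Rightarrow> 'o \<Rightarrow> 'm monoid" where
  "Hom_group C X Y = \<lparr>carrier = Hom C X Y, mult = hom_add C, one = hom_zero C X Y\<rparr>"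

definition hom_neg :: "('o, 'm, 'z) additive_data_scheme \<Rightarrow> 'm \<Rightarrow> 'm" where
  "hom_neg C f = inv\<^bsub>Hom_group C (src C f) (tgt C f)\<^esub> f"

locale additive_category = category C
  for C :: "('o, 'm, 'z) additive_data_scheme" (structure) +
  assumes Hom_comm_group: "X \<in> Obj C \<Longrightarrow> Y \<in> Obj C \<Longrightarrow> comm_group (Hom_group C X Y)"
    and cmp_add_left: "f \<in> Hom C X Y \<Longrightarrow> g \<in> Hom C Y Z \<Longrightarrow> g' \<in> Hom C Y Z \<Longrightarrow>
      (g \<oplus> g') \<cdot> f = (g \<cdot> f) \<oplus> (g' \<cdot> f)"
    and cmp_add_right: "f \<in> Hom C X Y \<Longrightarrow> f' \<in> Hom C X Y \<Longrightarrow> g \<in> Hom C Y Z \<Longrightarrow>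
      g \<cdot> (f \<oplus> f') = (g \<cdot> f) \<oplus> (g \<cdot> f')"
    and zero_object_exists: "\<exists>N. zero_object C N"
    and biproduct_exists: "X \<in> Obj C \<Longrightarrow> Y \<in> Obj C \<Longrightarrow>
      \<exists>P \<in> Obj C. \<exists>i \<in> Hom C X P. \<exists>j \<in> Hom C Y P. \<exists>p \<in> Hom C P X. \<exists>q \<in> Hom C P Y.
        p \<cdot> i = ident C X \<and> q \<cdot> j = ident C Y \<and>
        p \<cdot> j = hom_zero C Y X \<and> q \<cdot> i = hom_zero C X Y \<and>
        (i \<cdot> p) \<oplus> (j \<cdot> q) = ident C P"

text \<open>A triangle \<open>X \<rightarrow> Y \<rightarrow> Z \<rightarrow> \<Sigma> X\<close> is given by its three arrows.\<close>

record ('o, 'm) triangulated_data = "('o, 'm) additive_data" +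
  sus :: "'o \<Rightarrow> 'o"
  sus_arr :: "'m \<Rightarrow> 'm"
  dist_triangles :: "('m \<times> 'm \<times> 'm) set"

definition triangle_on :: "('o, 'm, 'z) triangulated_data_scheme \<Rightarrow>
    'm \<Rightarrow> 'm \<Rightarrow> 'm \<Rightarrow> 'o \<Rightarrow> 'o \<Rightarrow> 'o \<Rightarrow> bool" where
  "triangle_on C f g h X Y Z \<longleftrightarrow> f \<in> Hom C X Y \<and> g \<in> Hom C Y Z \<and> h \<in> Hom C Z (sus C X)"

definition dist_triangle_on :: "('o, 'm, 'z) triangulated_data_scheme \<Rightarrow>
    'm \<Rightarrow> 'm \<Rightarrow> 'm \<Rightarrow> 'o \<Rightarrow> 'o \<Rightarrow> 'o \<Rightarrow> bool" where
  "dist_triangle_on C f g h X Y Z \<longleftrightarrow>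
    triangle_on C f g h X Y Z \<and> (f, g, h) \<in> dist_triangles C"

text \<open>The translation functor is required to be an additive self-equivalence (fully faithful
  and essentially surjective); automorphisms of categories are a special case.
  The last axiom is Verdier's octahedral axiom.\<close>

locale triangulated_category = additive_category C
  for C :: "('o, 'm, 'z) triangulated_data_scheme" (structure) +
  assumes sus_closed: "X \<in> Obj C \<Longrightarrow> sus C X \<in> Obj C"
    and sus_arr_closed: "f \<in> Hom C X Y \<Longrightarrow> sus_arr C f \<in> Hom C (sus C X) (sus C Y)"
    and sus_ident: "X \<in> Obj C \<Longrightarrow> sus_arr C (ident C X) = ident C (sus C X)"
    and sus_cmp: "f \<in> Hom C X Y \<Longrightarrow> g \<in> Hom C Y Z \<Longrightarrow>
      sus_arr C (g \<cdot> f) = sus_arr C g \<cdot> sus_arr C f"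
    and sus_add: "f \<in> Hom C X Y \<Longrightarrow> f' \<in> Hom C X Y \<Longrightarrow>
      sus_arr C (f \<oplus> f') = sus_arr C f \<oplus> sus_arr C f'"
    and sus_fully_faithful: "X \<in> Obj C \<Longrightarrow> Y \<in> Obj C \<Longrightarrow>
      bij_betw (sus_arr C) (Hom C X Y) (Hom C (sus C X) (sus C Y))"
    and sus_essentially_surjective: "Y \<in> Obj C \<Longrightarrow> \<exists>X \<in> Obj C. isomorphic C (sus C X) Y"
    and dist_triangles_triangle: "(f, g, h) \<in> dist_triangles C \<Longrightarrow>
      \<exists>X Y Z. triangle_on C f g h X Y Z"
    and TR1_iso: "dist_triangle_on C f g h X Y Z \<Longrightarrow> triangle_on C f' g' h' X' Y' Z' \<Longrightarrow>
      iso_between C u X X' \<Longrightarrow> iso_between C v Y Y' \<Longrightarrow> iso_between C w Z Z' \<Longrightarrow>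
      v \<cdot> f = f' \<cdot> u \<Longrightarrow> w \<cdot> g = g' \<cdot> v \<Longrightarrow> sus_arr C u \<cdot> h = h' \<cdot> w \<Longrightarrow>
      (f', g', h') \<in> dist_triangles C"
    and TR1_ident: "X \<in> Obj C \<Longrightarrow> zero_object C N \<Longrightarrow>
      (ident C X, hom_zero C X N, hom_zero C N (sus C X)) \<in> dist_triangles C"
    and TR1_complete: "f \<in> Hom C X Y \<Longrightarrow> \<exists>g h Z. dist_triangle_on C f g h X Y Z"
    and TR2_rotate: "triangle_on C f g h X Y Z \<Longrightarrow>
      (f, g, h) \<in> dist_triangles C \<longleftrightarrow> (g, h, hom_neg C (sus_arr C f)) \<in> dist_triangles C"
    and TR3_morphism: "dist_triangle_on C f g h X Y Z \<Longrightarrow>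
      dist_triangle_on C f' g' h' X' Y' Z' \<Longrightarrow>
      u \<in> Hom C X X' \<Longrightarrow> v \<in> Hom C Y Y' \<Longrightarrow> v \<cdot> f = f' \<cdot> u \<Longrightarrow>
      \<exists>w \<in> Hom C Z Z'. w \<cdot> g = g' \<cdot> v \<and> sus_arr C u \<cdot> h = h' \<cdot> w"
    and TR4_octahedral: "dist_triangle_on C f f1 f2 X Y Z' \<Longrightarrow>
      dist_triangle_on C g g1 g2 Y Z X' \<Longrightarrow>
      dist_triangle_on C (g \<cdot> f) h1 h2 X Z Y' \<Longrightarrow>
      \<exists>u \<in> Hom C Z' Y'. \<exists>v \<in> Hom C Y' X'.
        (u, v, sus_arr C f1 \<cdot> g2) \<in> dist_triangles C \<and>
        u \<cdot> f1 = h1 \<cdot> g \<and> h2 \<cdot> u = f2 \<and>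
        v \<cdot> h1 = g1 \<and> g2 \<cdot> v = sus_arr C f \<cdot> h2"

text \<open>The subcategory \<open>\<Sigma>\<^sup>n A\<close> for an integer \<open>n\<close>, closed under isomorphism. At most one of
  \<open>nat n\<close> and \<open>nat (- n)\<close> is nonzero: for \<open>n \<ge> 0\<close> the condition is \<open>X \<cong> \<Sigma>\<^sup>n Y\<close>, and for
  \<open>n \<le> 0\<close> it is \<open>\<Sigma>\<^sup>-\<^sup>n X \<cong> Y\<close>, which avoids choosing a quasi-inverse of \<open>\<Sigma>\<close>.\<close>

definition sus_pow ::
    "('o, 'm, 'z) triangulated_data_scheme \<Rightarrow> int \<Rightarrow> 'o set \<Rightarrow> 'o set" where
  "sus_pow C n A = {X \<in> Obj C. \<exists>Y \<in> A.
     isomorphic C ((sus C ^^ nat (- n)) X) ((sus C ^^ nat n) Y)}"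

text \<open>A pair \<open>D\<close> stands for \<open>(D\<^sup>\<le>\<^sup>0, D\<^sup>\<ge>\<^sup>1)\<close>.\<close>

definition t_structure ::
    "('o, 'm, 'z) triangulated_data_scheme \<Rightarrow> 'o set \<times> 'o set \<Rightarrow> bool" where
  "t_structure C D \<longleftrightarrow>
     strict_full_subcategory C (fst D) \<and> strict_full_subcategory C (snd D) \<and>
     sus_pow C 1 (fst D) \<subseteq> fst D \<and> snd D \<subseteq> sus_pow C 1 (snd D) \<and>
     (\<forall>X \<in> fst D. \<forall>Y \<in> snd D. Hom C X Y = {hom_zero C X Y}) \<and>
     (\<forall>X \<in> Obj C. \<exists>X0 \<in> fst D. \<exists>X1 \<in> snd D. \<exists>f g h. dist_triangle_on C f g h X0 X X1)"

definition t_le ::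
    "('o, 'm, 'z) triangulated_data_scheme \<Rightarrow> 'o set \<times> 'o set \<Rightarrow> int \<Rightarrow> 'o set" where
  "t_le C D n = sus_pow C (- n) (fst D)"

definition t_ge ::
    "('o, 'm, 'z) triangulated_data_scheme \<Rightarrow> 'o set \<times> 'o set \<Rightarrow> int \<Rightarrow> 'o set" where
  "t_ge C D n = sus_pow C (- n + 1) (snd D)"

definition heart ::
    "('o, 'm, 'z) triangulated_data_scheme \<Rightarrow> 'o set \<times> 'o set \<Rightarrow> 'o set" where
  "heart C D = t_le C D 0 \<inter> t_ge C D 0"

definition stable_t_structure ::
    "('o, 'm, 'z) triangulated_data_scheme \<Rightarrow> 'o set \<times> 'o set \<Rightarrow> bool" where
  "stable_t_structure C D \<longleftrightarrow> t_structure C D \<and> sus_pow C 1 (fst D) = fst D"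

definition within_t_distance :: "('o, 'm, 'z) triangulated_data_scheme \<Rightarrow>
    'o set \<times> 'o set \<Rightarrow> 'o set \<times> 'o set \<Rightarrow> nat \<Rightarrow> bool" where
  "within_t_distance C D1 D2 d \<longleftrightarrow>
     (\<exists>m::int. t_le C D1 m \<subseteq> t_le C D2 0 \<and> t_le C D2 0 \<subseteq> t_le C D1 (m + int d))"

definition t_distance :: "('o, 'm, 'z) triangulated_data_scheme \<Rightarrow>
    'o set \<times> 'o set \<Rightarrow> 'o set \<times> 'o set \<Rightarrow> enat" where
  "t_distance C D1 D2 =
     (if \<exists>d. within_t_distance C D1 D2 d
      then enat (LEAST d. within_t_distance C D1 D2 d) else \<infinity>)"

end

theory Submission
  imports Defs
begin

text \<open>Aisle and coaisle of a t-structure determine each other by orthogonality and are closed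
  under extensions. Hence, by induction along the truncation triangles, for \<open>m \<ge> n\<^sub>1\<close> one has
  \<open>D\<^sub>1\<^sup>\<le>\<^sup>m \<subseteq> D\<^sub>2\<^sup>\<le>\<^sup>0\<close> iff the shifted hearts \<open>\<Sigma>\<^sup>-\<^sup>j H\<^sub>1\<close> with \<open>n\<^sub>1 < j \<le> m\<close> lie in \<open>D\<^sub>2\<^sup>\<le>\<^sup>0\<close>,
  and dually \<open>D\<^sub>2\<^sup>\<le>\<^sup>0 \<subseteq> D\<^sub>1\<^sup>\<le>\<^sup>m\<close> iff those with \<open>m < j \<le> n\<^sub>2\<close> lie in \<open>D\<^sub>2\<^sup>\<ge>\<^sup>1\<close>. So \<open>a\<close> is
  the largest \<open>m\<close> with \<open>D\<^sub>1\<^sup>\<le>\<^sup>m \<subseteq> D\<^sub>2\<^sup>\<le>\<^sup>0\<close> and \<open>b - 1\<close> the smallest with \<open>D\<^sub>2\<^sup>\<le>\<^sup>0 \<subseteq> D\<^sub>1\<^sup>\<le>\<^sup>m\<close>;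
  instability of \<open>D\<^sub>1\<close> makes the aisles \<open>D\<^sub>1\<^sup>\<le>\<^sup>m\<close> strictly increasing in \<open>m\<close>, which confines both
  to \<open>[n\<^sub>1, n\<^sub>2]\<close>.\<close>

section \<open>Isomorphisms, zero morphisms and negation\<close>

context category
begin

lemma Hom_obj:
  assumes "f \<in> Hom C X Y"
  shows "X \<in> Obj C" and "Y \<in> Obj C"
  using assms src_closed tgt_closed by (auto simp: Hom_def)

lemma isomorphicI:
  assumes "f \<in> Hom C X Y" "g \<in> Hom C Y X" "g \<cdot> f = ident C X" "f \<cdot> g = ident C Y"
  shows "isomorphic C X Y"
  using assms unfolding isomorphic_def iso_between_def by blast

lemma isomorphicE:
  assumes "isomorphic C X Y"
  obtains f g where "f \<in> Hom C X Y" "g \<in> Hom C Y X" "g \<cdot> f = ident C X" "f \<cdot> g = ident C Y"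
  using assms unfolding isomorphic_def iso_between_def by blast

lemma isomorphic_obj:
  assumes "isomorphic C X Y"
  shows "X \<in> Obj C" and "Y \<in> Obj C"
  using assms by (auto elim!: isomorphicE dest: Hom_obj)

lemma isomorphic_refl: "X \<in> Obj C \<Longrightarrow> isomorphic C X X"
  using ident_closed cmp_ident_left by (blast intro: isomorphicI)

lemma isomorphic_sym: "isomorphic C X Y \<Longrightarrow> isomorphic C Y X"
  by (blast elim: isomorphicE intro: isomorphicI)

lemma cmp_cancel_middle:
  assumes "f \<in> Hom C X Y" "h \<in> Hom C Y Z" "k \<in> Hom C Z Y" "g \<in> Hom C Y W"
    and "k \<cdot> h = ident C Y"
  shows "(g \<cdot> k) \<cdot> (h \<cdot> f) = g \<cdot> f"
proof -
  have "(g \<cdot> k) \<cdot> (h \<cdot> f) = g \<cdot> (k \<cdot> (h \<cdot> f))"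
    using assms cmp_assoc cmp_closed by blast
  also have "k \<cdot> (h \<cdot> f) = (k \<cdot> h) \<cdot> f"
    using assms cmp_assoc by metis
  finally show ?thesis
    using assms cmp_ident_left by simp
qed

lemma isomorphic_trans:
  assumes "isomorphic C X Y" "isomorphic C Y Z"
  shows "isomorphic C X Z"
proof -
  obtain f g where f: "f \<in> Hom C X Y" "g \<in> Hom C Y X" "g \<cdot> f = ident C X" "f \<cdot> g = ident C Y"
    using assms(1) by (rule isomorphicE)
  obtain h k where h: "h \<in> Hom C Y Z" "k \<in> Hom C Z Y" "k \<cdot> h = ident C Y" "h \<cdot> k = ident C Z"
    using assms(2) by (rule isomorphicE)
  show ?thesis
  proof (rule isomorphicI)
    show "h \<cdot> f \<in> Hom C X Z" "g \<cdot> k \<in> Hom C Z X"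
      using f h cmp_closed by blast+
    show "(g \<cdot> k) \<cdot> (h \<cdot> f) = ident C X" "(h \<cdot> f) \<cdot> (g \<cdot> k) = ident C Z"
      using f h cmp_cancel_middle by simp_all
  qed
qed

end

section \<open>Zero morphisms and negatives in an additive category\<close>

context additive_category
begin

lemma hom_zero_closed: "X \<in> Obj C \<Longrightarrow> Y \<in> Obj C \<Longrightarrow> hom_zero C X Y \<in> Hom C X Y"
  using comm_group.axioms(2)[OF Hom_comm_group, THEN group.is_monoid, THEN monoid.one_closed]
  by (simp add: Hom_group_def)

text \<open>Cancellation in the group of morphisms. Composition and \<Sigma> preserve zero morphisms
  by this criterion, since additivity makes the image of a zero morphism idempotent.\<close>

lemma hom_idem_zero:
  assumes "f \<in> Hom C X Y" "f \<oplus> f = f"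
  shows "f = hom_zero C X Y"
proof -
  interpret G: comm_group "Hom_group C X Y"
    using assms Hom_obj Hom_comm_group by blast
  show ?thesis
    using assms G.r_cancel_one[of f f] by (simp add: Hom_group_def)
qed

lemma hom_zero_add:
  "X \<in> Obj C \<Longrightarrow> Y \<in> Obj C \<Longrightarrow> hom_zero C X Y \<oplus> hom_zero C X Y = hom_zero C X Y"
  using comm_group.axioms(2)[OF Hom_comm_group, THEN group.is_monoid, THEN monoid.l_one]
    hom_zero_closed by (simp add: Hom_group_def)

lemma cmp_zero_left:
  assumes "f \<in> Hom C X Y" "Z \<in> Obj C"
  shows "hom_zero C Y Z \<cdot> f = hom_zero C X Z"
proof (rule hom_idem_zero)
  have Y: "Y \<in> Obj C"
    using assms Hom_obj by blast
  show "hom_zero C Y Z \<cdot> f \<in> Hom C X Z"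
    using assms Y hom_zero_closed cmp_closed by blast
  show "(hom_zero C Y Z \<cdot> f) \<oplus> (hom_zero C Y Z \<cdot> f) = hom_zero C Y Z \<cdot> f"
    using assms Y cmp_add_left[of f X Y "hom_zero C Y Z" Z "hom_zero C Y Z"]
    by (simp add: hom_zero_closed hom_zero_add)
qed

lemma cmp_zero_right:
  assumes "f \<in> Hom C X Y" "W \<in> Obj C"
  shows "f \<cdot> hom_zero C W X = hom_zero C W Y"
proof (rule hom_idem_zero)
  have X: "X \<in> Obj C"
    using assms Hom_obj by blast
  show "f \<cdot> hom_zero C W X \<in> Hom C W Y"
    using assms X hom_zero_closed cmp_closed by blast
  show "(f \<cdot> hom_zero C W X) \<oplus> (f \<cdot> hom_zero C W X) = f \<cdot> hom_zero C W X"
    using assms X cmp_add_right[of "hom_zero C W X" W X "hom_zero C W X" f Y]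
    by (simp add: hom_zero_closed hom_zero_add)
qed

lemma
  assumes "f \<in> Hom C X Y"
  shows hom_neg_closed: "hom_neg C f \<in> Hom C X Y"
    and hom_neg_add: "f \<oplus> hom_neg C f = hom_zero C X Y"
    and hom_neg_neg: "hom_neg C (hom_neg C f) = f"
proof -
  interpret G: comm_group "Hom_group C X Y"
    using assms Hom_obj Hom_comm_group by blast
  \<comment> \<open>\<open>hom_neg\<close> reads its group off the source and target of the arrow;
    this fixes the group once and for all.\<close>
  have neg: "hom_neg C g = inv\<^bsub>Hom_group C X Y\<^esub> g" if "g \<in> Hom C X Y" for g
    using that by (simp add: hom_neg_def Hom_def)
  have carr: "carrier (Hom_group C X Y) = Hom C X Y"
    by (simp add: Hom_group_def)
  show 1: "hom_neg C f \<in> Hom C X Y"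
    using assms neg G.inv_closed carr by simp
  show "f \<oplus> hom_neg C f = hom_zero C X Y"
    using assms neg G.r_inv[of f] carr by (simp add: Hom_group_def)
  show "hom_neg C (hom_neg C f) = f"
    using assms neg 1 G.inv_inv carr by simp
qed

lemma hom_neg_unique:
  assumes "f \<in> Hom C X Y" "g \<in> Hom C X Y" "f \<oplus> g = hom_zero C X Y"
  shows "g = hom_neg C f"
proof -
  interpret G: comm_group "Hom_group C X Y"
    using assms Hom_obj Hom_comm_group by blast
  show ?thesis
    using assms G.inv_equality[of g f] G.m_comm[of f g]
    by (auto simp: Hom_group_def hom_neg_def Hom_def)
qed

lemma hom_neg_zero:
  assumes "X \<in> Obj C" "Y \<in> Obj C"
  shows "hom_neg C (hom_zero C X Y) = hom_zero C X Y"
  using hom_neg_unique[OF hom_zero_closed hom_zero_closed] hom_zero_add assms by metis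

lemma cmp_neg_left:
  assumes "f \<in> Hom C X Y" "g \<in> Hom C Y Z"
  shows "hom_neg C g \<cdot> f = hom_neg C (g \<cdot> f)"
proof (rule hom_neg_unique)
  show "g \<cdot> f \<in> Hom C X Z" "hom_neg C g \<cdot> f \<in> Hom C X Z"
    using assms hom_neg_closed cmp_closed by blast+
  have "(g \<cdot> f) \<oplus> (hom_neg C g \<cdot> f) = hom_zero C Y Z \<cdot> f"
    using assms cmp_add_left hom_neg_closed hom_neg_add by metis
  then show "(g \<cdot> f) \<oplus> (hom_neg C g \<cdot> f) = hom_zero C X Z"
    using assms cmp_zero_left Hom_obj by metis
qed

lemma cmp_neg_right:
  assumes "f \<in> Hom C X Y" "g \<in> Hom C Y Z"
  shows "g \<cdot> hom_neg C f = hom_neg C (g \<cdot> f)"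
proof (rule hom_neg_unique)
  show "g \<cdot> f \<in> Hom C X Z" "g \<cdot> hom_neg C f \<in> Hom C X Z"
    using assms hom_neg_closed cmp_closed by blast+
  have "(g \<cdot> f) \<oplus> (g \<cdot> hom_neg C f) = g \<cdot> hom_zero C X Y"
    using assms cmp_add_right hom_neg_closed hom_neg_add by metis
  then show "(g \<cdot> f) \<oplus> (g \<cdot> hom_neg C f) = hom_zero C X Z"
    using assms cmp_zero_right Hom_obj by metis
qed

section \<open>Orthogonality of objects\<close>

definition orth :: "'o \<Rightarrow> 'o \<Rightarrow> bool" where
  "orth X Y \<longleftrightarrow> Hom C X Y = {hom_zero C X Y}"

lemma orthI:
  assumes "X \<in> Obj C" "Y \<in> Obj C" "\<And>f. f \<in> Hom C X Y \<Longrightarrow> f = hom_zero C X Y"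
  shows "orth X Y"
  using assms hom_zero_closed unfolding orth_def by blast

lemma orthD: "orth X Y \<Longrightarrow> f \<in> Hom C X Y \<Longrightarrow> f = hom_zero C X Y"
  by (simp add: orth_def)

text \<open>An equation with a singleton, unlike a vanishing condition on all morphisms, makes
  \<open>hom_zero C X Y\<close> an actual morphism, so its ends are objects.\<close>

lemma orth_obj:
  assumes "orth X Y"
  shows "X \<in> Obj C" and "Y \<in> Obj C"
proof -
  have "hom_zero C X Y \<in> Hom C X Y"
    using assms by (simp add: orth_def)
  then show "X \<in> Obj C" and "Y \<in> Obj C"
    by (rule Hom_obj)+
qed

text \<open>A morphism \<open>f\<close> out of the retract is recovered from
  \<open>f \<cdot> p\<close> by composing with \<open>i\<close>, and \<open>f \<cdot> p\<close>
  starts at \<open>X\<close>, so it vanishes.\<close>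

lemma orth_retract_left:
  assumes "orth X Y" "i \<in> Hom C X' X" "p \<in> Hom C X X'" "p \<cdot> i = ident C X'"
  shows "orth X' Y"
proof (rule orthI)
  have Y: "Y \<in> Obj C"
    using assms(1) by (rule orth_obj)
  then show "Y \<in> Obj C" .
  show "X' \<in> Obj C"
    using assms(2) by (rule Hom_obj)
  fix f assume f: "f \<in> Hom C X' Y"
  have "f = (f \<cdot> p) \<cdot> i"
    using cmp_assoc[OF assms(2,3) f] cmp_ident_right[OF f] assms(4) by simp
  also have "f \<cdot> p = hom_zero C X Y"
    using orthD[OF assms(1) cmp_closed[OF assms(3) f]] .
  finally show "f = hom_zero C X' Y"
    using cmp_zero_left[OF assms(2) Y] by simp
qed

lemma orth_retract_right:
  assumes "orth X Y" "i \<in> Hom C Y' Y" "p \<in> Hom C Y Y'" "p \<cdot> i = ident C Y'"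
  shows "orth X Y'"
proof (rule orthI)
  have X: "X \<in> Obj C"
    using assms(1) by (rule orth_obj)
  then show "X \<in> Obj C" .
  show "Y' \<in> Obj C"
    using assms(2) by (rule Hom_obj)
  fix f assume f: "f \<in> Hom C X Y'"
  have "f = p \<cdot> (i \<cdot> f)"
    using cmp_assoc[OF f assms(2,3)] cmp_ident_left[OF f] assms(4) by simp
  also have "i \<cdot> f = hom_zero C X Y"
    using orthD[OF assms(1) cmp_closed[OF f assms(2)]] .
  finally show "f = hom_zero C X Y'"
    using cmp_zero_right[OF assms(3) X] by simp
qed

lemma orth_iso:
  assumes "orth X Y" "isomorphic C X X'" "isomorphic C Y Y'"
  shows "orth X' Y'"
  using assms orth_retract_left orth_retract_right by (metis isomorphicE)

lemma zero_object_orth: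
  assumes "zero_object C N" "X \<in> Obj C"
  shows "orth N X" and "orth X N"
  using assms hom_zero_closed unfolding zero_object_def orth_def by blast+

text \<open>The identity of \<open>N\<close> is zero, and every morphism into or out of
  \<open>N\<close> factors through it.\<close>

lemma zero_objectI:
  assumes "orth N N"
  shows "zero_object C N"
proof -
  have N: "N \<in> Obj C"
    using assms by (rule orth_obj)
  have id: "ident C N = hom_zero C N N"
    using orthD[OF assms ident_closed[OF N]] .
  have "f = hom_zero C X N" if "f \<in> Hom C X N" for f X
    using cmp_ident_left[OF that] cmp_zero_left[OF that N] id by simp
  moreover have "f = hom_zero C N X" if "f \<in> Hom C N X" for f X
    using cmp_ident_right[OF that] cmp_zero_right[OF that N] id by simp
  ultimately show ?thesis
    using N hom_zero_closed unfolding zero_object_def by blast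
qed

end

section \<open>Distinguished triangles\<close>

context triangulated_category
begin

lemma sus_arr_zero:
  assumes "X \<in> Obj C" "Y \<in> Obj C"
  shows "sus_arr C (hom_zero C X Y) = hom_zero C (sus C X) (sus C Y)"
proof (rule hom_idem_zero)
  show "sus_arr C (hom_zero C X Y) \<in> Hom C (sus C X) (sus C Y)"
    using assms hom_zero_closed sus_arr_closed by blast
  show "sus_arr C (hom_zero C X Y) \<oplus> sus_arr C (hom_zero C X Y) = sus_arr C (hom_zero C X Y)"
    using sus_add[OF hom_zero_closed hom_zero_closed, OF assms assms] unfolding hom_zero_add[OF assms]
    by (rule sym)
qed

lemma sus_arr_surj:
  assumes "k \<in> Hom C (sus C X) (sus C Y)" "X \<in> Obj C" "Y \<in> Obj C"
  obtains f where "f \<in> Hom C X Y" "sus_arr C f = k"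
  using assms bij_betw_imp_surj_on[OF sus_fully_faithful, of X Y] that by (metis imageE)

lemma sus_arr_inj:
  assumes "f \<in> Hom C X Y" "g \<in> Hom C X Y" "sus_arr C f = sus_arr C g"
  shows "f = g"
  using bij_betw_imp_inj_on[OF sus_fully_faithful[OF Hom_obj[OF assms(1)]]] assms
  by (auto dest: inj_onD)

lemma isomorphic_sus:
  assumes "isomorphic C X Y"
  shows "isomorphic C (sus C X) (sus C Y)"
  using assms
proof (rule isomorphicE)
  fix f g
  assume f: "f \<in> Hom C X Y" "g \<in> Hom C Y X" "g \<cdot> f = ident C X" "f \<cdot> g = ident C Y"
  show ?thesis
    by (rule isomorphicI[OF sus_arr_closed[OF f(1)] sus_arr_closed[OF f(2)]])
      (simp_all add: f sus_cmp[OF f(1,2), symmetric] sus_cmp[OF f(2,1), symmetric]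
        sus_ident[OF Hom_obj(1)[OF f(1)]] sus_ident[OF Hom_obj(2)[OF f(1)]])
qed

text \<open>Fullness of \<Sigma> lifts both arrows of an inverse pair; faithfulness lifts the two
  equations between them.\<close>

lemma isomorphic_sus_iff:
  assumes "X \<in> Obj C" "Y \<in> Obj C"
  shows "isomorphic C (sus C X) (sus C Y) \<longleftrightarrow> isomorphic C X Y"
proof
  assume "isomorphic C (sus C X) (sus C Y)"
  then obtain f' g' where f': "f' \<in> Hom C (sus C X) (sus C Y)" "g' \<in> Hom C (sus C Y) (sus C X)"
      "g' \<cdot> f' = ident C (sus C X)" "f' \<cdot> g' = ident C (sus C Y)"
    by (rule isomorphicE)
  obtain f where f: "f \<in> Hom C X Y" "sus_arr C f = f'"
    using f' assms sus_arr_surj by metis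
  obtain g where g: "g \<in> Hom C Y X" "sus_arr C g = g'"
    using f' assms sus_arr_surj by metis
  show "isomorphic C X Y"
  proof (rule isomorphicI)
    show "g \<cdot> f = ident C X"
      by (rule sus_arr_inj[of _ X X]) (use f g f' assms cmp_closed ident_closed sus_cmp sus_ident in auto)
    show "f \<cdot> g = ident C Y"
      by (rule sus_arr_inj[of _ Y Y]) (use f g f' assms cmp_closed ident_closed sus_cmp sus_ident in auto)
  qed (use f g in auto)
qed (rule isomorphic_sus)

lemma orth_sus_iff:
  assumes X: "X \<in> Obj C" and Y: "Y \<in> Obj C"
  shows "orth (sus C X) (sus C Y) \<longleftrightarrow> orth X Y"
proof
  assume *: "orth (sus C X) (sus C Y)"
  show "orth X Y"
  proof (rule orthI[OF X Y])
    fix f assume f: "f \<in> Hom C X Y"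
    then have "sus_arr C f = sus_arr C (hom_zero C X Y)"
      using * orthD sus_arr_closed sus_arr_zero X Y by simp
    then show "f = hom_zero C X Y"
      using f sus_arr_inj hom_zero_closed X Y by blast
  qed
next
  assume *: "orth X Y"
  show "orth (sus C X) (sus C Y)"
  proof (rule orthI)
    fix k assume "k \<in> Hom C (sus C X) (sus C Y)"
    then obtain f where "f \<in> Hom C X Y" "sus_arr C f = k"
      using X Y sus_arr_surj by metis
    then show "k = hom_zero C (sus C X) (sus C Y)"
      using * orthD sus_arr_zero X Y by metis
  qed (use X Y sus_closed in auto)
qed

text \<open>Closure arguments for t-structures only need some triangle on the given objects;
  forgetting the arrows also absorbs the signs of rotation.\<close>

definition tri :: "'o \<Rightarrow> 'o \<Rightarrow> 'o \<Rightarrow> bool" where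
  "tri X Y Z \<longleftrightarrow> (\<exists>f g h. dist_triangle_on C f g h X Y Z)"

lemma dist_triangle_onD:
  assumes "dist_triangle_on C f g h X Y Z"
  shows "f \<in> Hom C X Y" and "g \<in> Hom C Y Z" and "h \<in> Hom C Z (sus C X)"
    and "X \<in> Obj C" and "Y \<in> Obj C" and "Z \<in> Obj C"
  using assms Hom_obj unfolding dist_triangle_on_def triangle_on_def by blast+

lemma tri_obj:
  assumes "tri X Y Z"
  shows "X \<in> Obj C" and "Y \<in> Obj C" and "Z \<in> Obj C"
  using assms by (auto simp: tri_def dest: dist_triangle_onD)

lemma dist_triangle_rotate:
  assumes "dist_triangle_on C f g h X Y Z"
  shows "dist_triangle_on C g h (hom_neg C (sus_arr C f)) Y Z (sus C X)"
  using assms TR2_rotate hom_neg_closed sus_arr_closed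
  unfolding dist_triangle_on_def triangle_on_def by blast

lemma tri_rotate: "tri X Y Z \<Longrightarrow> tri Y Z (sus C X)"
  using dist_triangle_rotate unfolding tri_def by blast

text \<open>Fullness of \<Sigma> gives \<open>f\<close> with \<open>sus_arr C f\<close> equal to the
  negative of the third arrow; double negation then matches the rotation axiom read
  backwards.\<close>

lemma tri_unrotate:
  assumes "tri Y Z (sus C X)" "X \<in> Obj C"
  shows "tri X Y Z"
proof -
  obtain g h k where T: "dist_triangle_on C g h k Y Z (sus C X)"
    using assms unfolding tri_def by blast
  note H = dist_triangle_onD[OF T]
  obtain f where f: "f \<in> Hom C X Y" "sus_arr C f = hom_neg C k"
    using sus_arr_surj[OF hom_neg_closed[OF H(3)] assms(2) H(4)] by blast
  have "hom_neg C (sus_arr C f) = k"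
    using f hom_neg_neg[OF H(3)] by simp
  then have "dist_triangle_on C f g h X Y Z"
    using T H f(1) TR2_rotate[of f g h X Y Z] unfolding dist_triangle_on_def triangle_on_def by simp
  then show ?thesis
    unfolding tri_def by blast
qed

text \<open>Three rotations suspend all three objects, and each of them can be undone.\<close>

lemma tri_sus_iff:
  assumes "X \<in> Obj C" "Y \<in> Obj C" "Z \<in> Obj C"
  shows "tri (sus C X) (sus C Y) (sus C Z) \<longleftrightarrow> tri X Y Z"
  using assms tri_rotate tri_unrotate by metis

lemma tri_iso:
  assumes "tri X Y Z" "isomorphic C X X'" "isomorphic C Y Y'" "isomorphic C Z Z'"
  shows "tri X' Y' Z'"
proof -
  obtain f g h where T: "dist_triangle_on C f g h X Y Z"
    using assms unfolding tri_def by blast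
  note H = dist_triangle_onD[OF T]
  obtain u u' where u: "u \<in> Hom C X X'" "u' \<in> Hom C X' X" "u' \<cdot> u = ident C X" "u \<cdot> u' = ident C X'"
    using assms(2) by (rule isomorphicE)
  obtain v v' where v: "v \<in> Hom C Y Y'" "v' \<in> Hom C Y' Y" "v' \<cdot> v = ident C Y" "v \<cdot> v' = ident C Y'"
    using assms(3) by (rule isomorphicE)
  obtain w w' where w: "w \<in> Hom C Z Z'" "w' \<in> Hom C Z' Z" "w' \<cdot> w = ident C Z" "w \<cdot> w' = ident C Z'"
    using assms(4) by (rule isomorphicE)
  define f' where "f' = (v \<cdot> f) \<cdot> u'"
  define g' where "g' = (w \<cdot> g) \<cdot> v'"
  define h' where "h' = (sus_arr C u \<cdot> h) \<cdot> w'"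
  \<comment> \<open>The new arrows are conjugates of the old ones; cancelling \<open>p'\<close>
    against \<open>p\<close> yields each of the three commuting squares.\<close>
  have transport: "((q \<cdot> k) \<cdot> p') \<cdot> p = q \<cdot> k"
    if "k \<in> Hom C P Q" "q \<in> Hom C Q Q'" "p \<in> Hom C P P'" "p' \<in> Hom C P' P" "p' \<cdot> p = ident C P"
    for k q p p' P Q P' Q'
    using cmp_assoc[OF that(3,4) cmp_closed[OF that(1,2)]] cmp_ident_right[OF cmp_closed[OF that(1,2)]]
      that(5) by simp
  have Su: "sus_arr C u \<in> Hom C (sus C X) (sus C X')"
    using u sus_arr_closed by blast
  have T': "triangle_on C f' g' h' X' Y' Z'"
    unfolding triangle_on_def f'_def g'_def h'_def
    by (intro conjI cmp_closed[OF u(2) cmp_closed[OF H(1) v(1)]]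
        cmp_closed[OF v(2) cmp_closed[OF H(2) w(1)]] cmp_closed[OF w(2) cmp_closed[OF H(3) Su]])
  have "(f', g', h') \<in> dist_triangles C"
  proof (rule TR1_iso[OF T T'])
    show "iso_between C u X X'" "iso_between C v Y Y'" "iso_between C w Z Z'"
      using u v w unfolding iso_between_def by blast+
    show "v \<cdot> f = f' \<cdot> u" "w \<cdot> g = g' \<cdot> v" "sus_arr C u \<cdot> h = h' \<cdot> w"
      unfolding f'_def g'_def h'_def
      using transport[OF H(1) v(1) u(1-3)] transport[OF H(2) w(1) v(1-3)]
        transport[OF H(3) Su w(1-3)] by simp_all
  qed
  then show ?thesis
    using T' unfolding tri_def dist_triangle_on_def by blast
qed

section \<open>Exactness of Hom and orthogonality of extensions\<close>

lemma zero_object_sus: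
  assumes "zero_object C N"
  shows "zero_object C (sus C N)"
proof -
  have "N \<in> Obj C"
    using assms unfolding zero_object_def by blast
  then have "orth (sus C N) (sus C N)"
    using zero_object_orth(1)[OF assms] orth_sus_iff by simp
  then show ?thesis
    by (rule zero_objectI)
qed

text \<open>Exactness of Hom(-, \<open>W\<close>) at \<open>Y\<close>: \<open>w\<close> is the third
  component of a morphism to the trivial triangle \<open>N\<close>, \<open>W\<close>,
  \<open>W\<close>.\<close>

lemma factor_through_second:
  assumes T: "dist_triangle_on C f g h X Y Z"
    and p: "p \<in> Hom C Y W" and pf: "p \<cdot> f = hom_zero C X W"
  obtains w where "w \<in> Hom C Z W" "w \<cdot> g = p"
proof -
  obtain N where N: "zero_object C N"
    using zero_object_exists by blast
  have obj: "N \<in> Obj C" "W \<in> Obj C"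
    using N p Hom_obj unfolding zero_object_def by blast+
  note H = dist_triangle_onD[OF T]
  have tr: "triangle_on C (hom_zero C N W) (ident C W) (hom_zero C W (sus C N)) N W W"
    using obj hom_zero_closed ident_closed sus_closed unfolding triangle_on_def by blast
  \<comment> \<open>The trivial triangle comes from rotating the identity triangle of
    \<open>W\<close> backwards, with the zero object \<open>sus C N\<close> as its third
    term.\<close>
  have "(ident C W, hom_zero C W (sus C N), hom_zero C (sus C N) (sus C W)) \<in> dist_triangles C"
    using TR1_ident obj zero_object_sus N by blast
  then have "(hom_zero C N W, ident C W, hom_zero C W (sus C N)) \<in> dist_triangles C"
    using TR2_rotate[OF tr] obj by (simp add: sus_arr_zero hom_neg_zero sus_closed)
  then have T': "dist_triangle_on C (hom_zero C N W) (ident C W) (hom_zero C W (sus C N)) N W W"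
    using tr unfolding dist_triangle_on_def by blast
  have "p \<cdot> f = hom_zero C N W \<cdot> hom_zero C X N"
    using pf cmp_zero_left[OF hom_zero_closed] H obj by simp
  then obtain w where "w \<in> Hom C Z W" "w \<cdot> g = ident C W \<cdot> p"
    using TR3_morphism[OF T T' hom_zero_closed[OF H(4) obj(1)] p] by blast
  then show ?thesis
    using that cmp_ident_left[OF p] by simp
qed

text \<open>Exactness of Hom(\<open>W\<close>, -) at \<open>Y\<close>. Both triangles are rotated
  once, so that the wanted arrow appears, suspended, as the third component that TR3
  supplies.\<close>

lemma factor_through_first:
  assumes T: "dist_triangle_on C f g h X Y Z"
    and p: "p \<in> Hom C W Y" and gp: "g \<cdot> p = hom_zero C W Z"
  obtains s where "s \<in> Hom C W X" "f \<cdot> s = p"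
proof -
  obtain N where N: "zero_object C N"
    using zero_object_exists by blast
  have obj: "N \<in> Obj C" "W \<in> Obj C"
    using N p Hom_obj unfolding zero_object_def by blast+
  note H = dist_triangle_onD[OF T]
  have "dist_triangle_on C (ident C W) (hom_zero C W N) (hom_zero C N (sus C W)) W W N"
    using TR1_ident[OF obj(2) N] obj hom_zero_closed ident_closed sus_closed
    unfolding dist_triangle_on_def triangle_on_def by blast
  from dist_triangle_rotate[OF this]
  have T': "dist_triangle_on C (hom_zero C W N) (hom_zero C N (sus C W))
      (hom_neg C (ident C (sus C W))) W N (sus C W)"
    using obj sus_ident by simp
  note T2 = dist_triangle_rotate[OF T]
  have eq: "hom_zero C N Z \<cdot> hom_zero C W N = g \<cdot> p"
    using gp cmp_zero_left[OF hom_zero_closed] H obj by simp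
  obtain w where w: "w \<in> Hom C (sus C W) (sus C X)"
    "sus_arr C p \<cdot> hom_neg C (ident C (sus C W)) = hom_neg C (sus_arr C f) \<cdot> w"
    using TR3_morphism[OF T' T2 p hom_zero_closed[OF obj(1) H(6)] eq] by blast
  have Sp: "sus_arr C p \<in> Hom C (sus C W) (sus C Y)"
    and Sf: "sus_arr C f \<in> Hom C (sus C X) (sus C Y)"
    using p H sus_arr_closed by blast+
  \<comment> \<open>Each rotated triangle contributes one minus sign, and the signs cancel.\<close>
  have "hom_neg C (sus_arr C p) = hom_neg C (sus_arr C f \<cdot> w)"
    using w cmp_neg_left[OF w(1) Sf] cmp_neg_right[OF ident_closed Sp] cmp_ident_right[OF Sp]
      obj sus_closed by simp
  then have Sp_eq: "sus_arr C p = sus_arr C f \<cdot> w"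
    by (metis hom_neg_neg[OF Sp] hom_neg_neg[OF cmp_closed[OF w(1) Sf]])
  obtain s where s: "s \<in> Hom C W X" "sus_arr C s = w"
    using sus_arr_surj[OF w(1) obj(2) H(4)] by blast
  have "f \<cdot> s = p"
    by (rule sus_arr_inj[OF cmp_closed[OF s(1) H(1)] p]) (use s Sp_eq sus_cmp[OF s(1) H(1)] in simp)
  with s(1) show ?thesis
    by (rule that)
qed

text \<open>A morphism from \<open>Y\<close> to \<open>W\<close> vanishes on \<open>X\<close>, hence
  factors through \<open>Z\<close>, where it vanishes too.\<close>

lemma orth_extension_left:
  assumes "tri X Y Z" "orth X W" "orth Z W"
  shows "orth Y W"
proof -
  obtain f g h where T: "dist_triangle_on C f g h X Y Z"
    using assms unfolding tri_def by blast
  note H = dist_triangle_onD[OF T]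
  have W: "W \<in> Obj C"
    using assms(2) orth_obj by blast
  show ?thesis
  proof (rule orthI[OF H(5) W])
    fix p assume p: "p \<in> Hom C Y W"
    then have "p \<cdot> f = hom_zero C X W"
      using orthD[OF assms(2) cmp_closed[OF H(1)]] by simp
    then obtain w where "w \<in> Hom C Z W" "w \<cdot> g = p"
      using factor_through_second[OF T p] by blast
    then show "p = hom_zero C Y W"
      using orthD[OF assms(3)] cmp_zero_left[OF H(2) W] by simp
  qed
qed

lemma orth_extension_right:
  assumes "tri X Y Z" "orth W X" "orth W Z"
  shows "orth W Y"
proof -
  obtain f g h where T: "dist_triangle_on C f g h X Y Z"
    using assms unfolding tri_def by blast
  note H = dist_triangle_onD[OF T]
  have W: "W \<in> Obj C"
    using assms(2) orth_obj by blast
  show ?thesis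
  proof (rule orthI[OF W H(5)])
    fix p assume p: "p \<in> Hom C W Y"
    then have "g \<cdot> p = hom_zero C W Z"
      using orthD[OF assms(3) cmp_closed[OF _ H(2)]] by simp
    then obtain s where "s \<in> Hom C W X" "f \<cdot> s = p"
      using factor_through_first[OF T p] by blast
    then show "p = hom_zero C W Y"
      using orthD[OF assms(2)] cmp_zero_right[OF H(1) W] by auto
  qed
qed

text \<open>Since \<open>g\<close> and \<open>h\<close> vanish, exactness gives \<open>f\<close> a
  right inverse at \<open>Y\<close> and, in the twice rotated triangle, \<open>sus_arr C f\<close> a
  left inverse up to sign; desuspended, the two inverses agree.\<close>

lemma tri_zero_third:
  assumes "tri X Y Z" "orth Z Z"
  shows "isomorphic C X Y"
proof -
  obtain f g h where T: "dist_triangle_on C f g h X Y Z"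
    using assms unfolding tri_def by blast
  note H = dist_triangle_onD[OF T]
  have zero: "zero_object C Z"
    using assms(2) by (rule zero_objectI)
  have Sf: "sus_arr C f \<in> Hom C (sus C X) (sus C Y)"
    using H sus_arr_closed by blast
  have "g \<cdot> ident C Y = hom_zero C Y Z"
    using orthD[OF zero_object_orth(2)[OF zero H(5)] H(2)] cmp_ident_right[OF H(2)] by simp
  then obtain s where s: "s \<in> Hom C Y X" "f \<cdot> s = ident C Y"
    using factor_through_first[OF T ident_closed] H by blast
  have "ident C (sus C X) \<cdot> h = hom_zero C Z (sus C X)"
    using orthD[OF zero_object_orth(1)[OF zero sus_closed[OF H(4)]] H(3)] cmp_ident_left[OF H(3)]
    by simp
  then obtain t where t: "t \<in> Hom C (sus C Y) (sus C X)"
    "t \<cdot> hom_neg C (sus_arr C f) = ident C (sus C X)"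
    using factor_through_second[OF dist_triangle_rotate[OF dist_triangle_rotate[OF T]] ident_closed]
      H sus_closed by blast
  obtain r where r: "r \<in> Hom C Y X" "sus_arr C r = hom_neg C t"
    using sus_arr_surj[OF hom_neg_closed[OF t(1)]] H by blast
  have "sus_arr C r \<cdot> sus_arr C f = ident C (sus C X)"
    using r t cmp_neg_left[OF Sf t(1)] cmp_neg_right[OF Sf t(1)] by simp
  then have rf: "r \<cdot> f = ident C X"
    using sus_arr_inj[OF cmp_closed[OF H(1) r(1)] ident_closed] sus_cmp[OF H(1) r(1)] sus_ident H
    by simp
  have "r = s"
    using cmp_assoc[OF s(1) H(1) r(1)] rf s(2) cmp_ident_left[OF s(1)] cmp_ident_right[OF r(1)] by simp
  then show ?thesis
    using isomorphicI[OF H(1) s(1)] rf s by simp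
qed

section \<open>Integer suspensions of a subcategory\<close>

abbreviation strict :: "'o set \<Rightarrow> bool" where
  "strict \<equiv> strict_full_subcategory C"

lemma strict_obj: "strict A \<Longrightarrow> X \<in> A \<Longrightarrow> X \<in> Obj C"
  unfolding strict_full_subcategory_def by blast

lemma strict_iso: "strict A \<Longrightarrow> X \<in> A \<Longrightarrow> isomorphic C X Y \<Longrightarrow> Y \<in> A"
  using isomorphic_obj unfolding strict_full_subcategory_def by blast

lemma sus_funpow_closed: "X \<in> Obj C \<Longrightarrow> (sus C ^^ n) X \<in> Obj C"
  by (induction n) (auto simp: sus_closed)

lemma isomorphic_sus_funpow:
  "isomorphic C X Y \<Longrightarrow> isomorphic C ((sus C ^^ n) X) ((sus C ^^ n) Y)"
  by (induction n) (auto simp: isomorphic_sus)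

lemma strict_sus_pow: "strict (sus_pow C n A)"
  unfolding strict_full_subcategory_def
proof (intro conjI ballI impI)
  show "sus_pow C n A \<subseteq> Obj C"
    by (auto simp: sus_pow_def)
  fix X Y
  assume X: "X \<in> sus_pow C n A" and Y: "Y \<in> Obj C" and XY: "isomorphic C X Y"
  obtain Z where Z: "Z \<in> A" "isomorphic C ((sus C ^^ nat (- n)) X) ((sus C ^^ nat n) Z)"
    using X by (auto simp: sus_pow_def)
  have "isomorphic C ((sus C ^^ nat (- n)) Y) ((sus C ^^ nat n) Z)"
    using isomorphic_trans[OF isomorphic_sus_funpow[OF isomorphic_sym[OF XY]] Z(2)] .
  then show "Y \<in> sus_pow C n A"
    using Y Z(1) by (auto simp: sus_pow_def)
qed

lemma sus_pow_0: "strict A \<Longrightarrow> sus_pow C 0 A = A"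
  by (auto simp: sus_pow_def intro: strict_iso isomorphic_sym isomorphic_refl strict_obj)

text \<open>For \<open>n \<ge> 0\<close> the power acts on the member of \<open>A\<close>, and one
  \<Sigma> is cancelled on both sides; for \<open>n < 0\<close> it acts on \<open>X\<close>, and the
  extra \<Sigma> is merely one more iterate.\<close>

lemma sus_in_sus_pow_iff:
  assumes A: "strict A" and X: "X \<in> Obj C"
  shows "sus C X \<in> sus_pow C (n + 1) A \<longleftrightarrow> X \<in> sus_pow C n A"
proof (cases "n \<ge> 0")
  case True
  then have "nat (n + 1) = Suc (nat n)" "nat (- n) = 0" "nat (- (n + 1)) = 0"
    by auto
  moreover have "isomorphic C (sus C X) (sus C ((sus C ^^ nat n) Y)) \<longleftrightarrow>
      isomorphic C X ((sus C ^^ nat n) Y)" if "Y \<in> A" for Y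
    using isomorphic_sus_iff[OF X sus_funpow_closed[OF strict_obj[OF A that]]] .
  ultimately show ?thesis
    using X sus_closed unfolding sus_pow_def by auto
next
  case False
  then have "nat (- n) = Suc (nat (- (n + 1)))" "nat n = 0" "nat (n + 1) = 0"
    by auto
  then show ?thesis
    using X sus_closed unfolding sus_pow_def by (simp add: funpow_swap1)
qed

text \<open>A family of strict subcategories \<open>F n\<close> that behaves like \<open>\<Sigma>\<^sup>n A\<close> is determined
  by any single member; working with such families avoids choosing a quasi-inverse of \<open>\<Sigma>\<close>.\<close>

definition shift_family :: "(int \<Rightarrow> 'o set) \<Rightarrow> bool" where
  "shift_family F \<longleftrightarrow>
    (\<forall>n. strict (F n)) \<and> (\<forall>n. \<forall>X \<in> Obj C. sus C X \<in> F (n + 1) \<longleftrightarrow> X \<in> F n)"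

lemma shift_family_sus_pow: "strict A \<Longrightarrow> shift_family (\<lambda>n. sus_pow C n A)"
  unfolding shift_family_def using strict_sus_pow sus_in_sus_pow_iff by blast

text \<open>Upwards, essential surjectivity replaces an object by an isomorphic suspension, and
  strictness carries membership across the isomorphism.\<close>

lemma shift_family_subset_step:
  assumes F: "shift_family F" and G: "shift_family G"
  shows "F (n + 1) \<subseteq> G (m + 1) \<longleftrightarrow> F n \<subseteq> G m"
proof
  assume "F (n + 1) \<subseteq> G (m + 1)"
  then show "F n \<subseteq> G m"
    using F G strict_obj unfolding shift_family_def by blast
next
  assume sub: "F n \<subseteq> G m"
  show "F (n + 1) \<subseteq> G (m + 1)"
  proof
    fix Y assume Y: "Y \<in> F (n + 1)"
    then have "Y \<in> Obj C"
      using F strict_obj unfolding shift_family_def by blast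
    then obtain X where X: "X \<in> Obj C" "isomorphic C (sus C X) Y"
      using sus_essentially_surjective by blast
    then have "sus C X \<in> F (n + 1)"
      using F Y strict_iso isomorphic_sym unfolding shift_family_def by blast
    then have "sus C X \<in> G (m + 1)"
      using F G X sub unfolding shift_family_def by blast
    then show "Y \<in> G (m + 1)"
      using G X strict_iso unfolding shift_family_def by blast
  qed
qed

lemma int_shift_invariant:
  fixes P :: "int \<Rightarrow> bool"
  assumes "\<And>n. P (n + 1) \<longleftrightarrow> P n"
  shows "P n \<longleftrightarrow> P m"
proof (induction n rule: int_induct[of _ m])
  case (step2 i)
  then show ?case using assms[of "i - 1"] by simp
qed (use assms in auto)

lemma shift_family_subset:
  assumes "shift_family F" "shift_family G"
  shows "F (n + k) \<subseteq> G (m + k) \<longleftrightarrow> F n \<subseteq> G m"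
  using int_shift_invariant[of "\<lambda>k. F (n + k) \<subseteq> G (m + k)" k 0]
    shift_family_subset_step[OF assms] by (simp add: add.assoc[symmetric])

text \<open>The powers of \<open>F 0\<close> form a second shift family that agrees with
  \<open>F\<close> in degree 0; both inclusions are then moved to degree \<open>n\<close>.\<close>

lemma sus_pow_eq_shift_family:
  assumes "shift_family F"
  shows "sus_pow C n (F 0) = F n"
proof -
  have F0: "strict (F 0)"
    using assms unfolding shift_family_def by blast
  note S = shift_family_sus_pow[OF F0]
  show ?thesis
    using shift_family_subset[OF S assms, of 0 n 0] shift_family_subset[OF assms S, of 0 n 0]
      sus_pow_0[OF F0] by auto
qed

end

section \<open>t-structures\<close>

locale t_structured_category = triangulated_category C
  for C :: "('o, 'm, 'z) triangulated_data_scheme" (structure) +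
  fixes D :: "'o set \<times> 'o set"
  assumes t_structure: "t_structure C D"
begin

abbreviation L :: "int \<Rightarrow> 'o set" where "L \<equiv> t_le C D"
abbreviation G :: "int \<Rightarrow> 'o set" where "G \<equiv> t_ge C D"

lemma strict_fst: "strict (fst D)" and strict_snd: "strict (snd D)"
  using t_structure unfolding t_structure_def by auto

lemma L_0: "L 0 = fst D"
  unfolding t_le_def using sus_pow_0[OF strict_fst] by simp

lemma G_1: "G 1 = snd D"
  unfolding t_ge_def using sus_pow_0[OF strict_snd] by simp

lemma strict_L: "strict (L n)" and strict_G: "strict (G n)"
  unfolding t_le_def t_ge_def by (rule strict_sus_pow)+

text \<open>The index is negated because \<open>t_le\<close> in degree \<open>n\<close> is the power
  \<open>- n\<close> of the aisle.\<close>

lemma shift_family_L: "shift_family (\<lambda>n. L (- n))"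
  unfolding t_le_def using shift_family_sus_pow[OF strict_fst] by simp

lemma shift_family_G: "shift_family (\<lambda>n. G (- n))"
  unfolding shift_family_def
proof (intro conjI allI ballI)
  fix n :: int and X assume X: "X \<in> Obj C"
  have "- (- (n + 1)) + 1 = (n + 1) + 1" "- (- n) + 1 = n + 1"
    by simp_all
  then show "sus C X \<in> G (- (n + 1)) \<longleftrightarrow> X \<in> G (- n)"
    unfolding t_ge_def using sus_in_sus_pow_iff[OF strict_snd X, of "n + 1"] by (simp only:)
qed (rule strict_G)

lemma sus_in_shift_family_iff:
  assumes "shift_family (\<lambda>n. F (- n))" "X \<in> Obj C"
  shows "sus C X \<in> F n \<longleftrightarrow> X \<in> F (n + 1)"
proof -
  have "sus C X \<in> F (- (- (n + 1) + 1)) \<longleftrightarrow> X \<in> F (- (- (n + 1)))"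
    using assms unfolding shift_family_def by blast
  then show ?thesis
    by (simp add: add.commute)
qed

lemma sus_in_L_iff: "X \<in> Obj C \<Longrightarrow> sus C X \<in> L n \<longleftrightarrow> X \<in> L (n + 1)"
  by (rule sus_in_shift_family_iff[OF shift_family_L])

lemma sus_in_G_iff: "X \<in> Obj C \<Longrightarrow> sus C X \<in> G n \<longleftrightarrow> X \<in> G (n + 1)"
  by (rule sus_in_shift_family_iff[OF shift_family_G])

section \<open>The axioms of a t-structure in every degree\<close>

lemma L_subset_shift: "L (n + k) \<subseteq> L (m + k) \<longleftrightarrow> L n \<subseteq> L m"
  using shift_family_subset[OF shift_family_L shift_family_L, of "- n" "- k" "- m"]
  by (simp add: add.commute)

lemma G_subset_shift: "G (n + k) \<subseteq> G (m + k) \<longleftrightarrow> G n \<subseteq> G m"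
  using shift_family_subset[OF shift_family_G shift_family_G, of "- n" "- k" "- m"]
  by (simp add: add.commute)

lemma L_mono:
  assumes "n \<le> m"
  shows "L n \<subseteq> L m"
  using assms
proof (induction m rule: int_ge_induct)
  case (step i)
  have "L (- 1) \<subseteq> L 0"
    using t_structure L_0 unfolding t_structure_def t_le_def by simp
  then have "L i \<subseteq> L (i + 1)"
    using L_subset_shift[of "- 1" "i + 1" 0] by simp
  with step show ?case by blast
qed simp

lemma G_antimono:
  assumes "n \<le> m"
  shows "G m \<subseteq> G n"
  using assms
proof (induction m rule: int_ge_induct)
  case (step i)
  have "G 1 \<subseteq> G 0"
    using t_structure G_1 unfolding t_structure_def t_ge_def by simp
  then have "G (i + 1) \<subseteq> G i"
    using G_subset_shift[of 1 i 0] by (simp add: add.commute)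
  with step show ?case by blast
qed simp

text \<open>Degree 0 is (T2). \<Sigma> preserves and reflects orthogonality, and every object is a
  suspension up to isomorphism, so the statement passes between adjacent degrees.\<close>

lemma orth_L_G:
  assumes "X \<in> L n" "Y \<in> G (n + 1)"
  shows "orth X Y"
proof -
  let ?P = "\<lambda>n. \<forall>X \<in> L n. \<forall>Y \<in> G (n + 1). orth X Y"
  have "?P (n + 1) \<longleftrightarrow> ?P n" for n
  proof
    assume P: "?P (n + 1)"
    show "?P n"
    proof (intro ballI)
      fix X Y assume XY: "X \<in> L n" "Y \<in> G (n + 1)"
      obtain X' where X': "X' \<in> Obj C" "isomorphic C (sus C X') X"
        using XY strict_L strict_obj sus_essentially_surjective by blast
      obtain Y' where Y': "Y' \<in> Obj C" "isomorphic C (sus C Y') Y"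
        using XY strict_G strict_obj sus_essentially_surjective by blast
      have "X' \<in> L (n + 1)" "Y' \<in> G (n + 1 + 1)"
        using strict_iso[OF strict_L XY(1) isomorphic_sym[OF X'(2)]]
          strict_iso[OF strict_G XY(2) isomorphic_sym[OF Y'(2)]]
        by (simp_all only: sus_in_L_iff[OF X'(1)] sus_in_G_iff[OF Y'(1)])
      then show "orth X Y"
        using P orth_iso[OF _ X'(2) Y'(2)] orth_sus_iff[OF X'(1) Y'(1)] by simp
    qed
  next
    assume P: "?P n"
    show "?P (n + 1)"
    proof (intro ballI)
      fix X Y assume XY: "X \<in> L (n + 1)" "Y \<in> G (n + 1 + 1)"
      then have obj: "X \<in> Obj C" "Y \<in> Obj C"
        using strict_L strict_G strict_obj by blast+
      then have "orth (sus C X) (sus C Y)"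
        using P XY sus_in_L_iff sus_in_G_iff by blast
      then show "orth X Y"
        using obj orth_sus_iff by blast
    qed
  qed
  moreover have "?P 0"
    using t_structure L_0 G_1 unfolding t_structure_def orth_def by simp
  ultimately have "?P n"
    using int_shift_invariant[of ?P n 0] by blast
  then show ?thesis
    using assms by blast
qed

text \<open>Degree 0 is (T3); the other degrees follow because \<Sigma> preserves and reflects
  triangles.\<close>

lemma truncation:
  assumes "X \<in> Obj C"
  obtains X0 X1 where "X0 \<in> L n" "X1 \<in> G (n + 1)" "tri X0 X X1"
proof -
  let ?P = "\<lambda>n. \<forall>X \<in> Obj C. \<exists>X0 \<in> L n. \<exists>X1 \<in> G (n + 1). tri X0 X X1"
  have "?P (n + 1) \<longleftrightarrow> ?P n" for n
  proof
    assume P: "?P (n + 1)"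
    show "?P n"
    proof
      fix X assume "X \<in> Obj C"
      then obtain X' where X': "X' \<in> Obj C" "isomorphic C (sus C X') X"
        using sus_essentially_surjective by blast
      then obtain X0 X1 where T: "X0 \<in> L (n + 1)" "X1 \<in> G (n + 1 + 1)" "tri X0 X' X1"
        using P by blast
      note obj = tri_obj[OF T(3)]
      have "tri (sus C X0) X (sus C X1)"
        using tri_iso[OF _ isomorphic_refl X'(2) isomorphic_refl] tri_sus_iff[OF obj] T(3)
          obj sus_closed by simp
      then show "\<exists>X0 \<in> L n. \<exists>X1 \<in> G (n + 1). tri X0 X X1"
        using T obj sus_in_L_iff sus_in_G_iff by blast
    qed
  next
    assume P: "?P n"
    show "?P (n + 1)"
    proof
      fix X assume X: "X \<in> Obj C"
      then obtain Y0 Y1 where T: "Y0 \<in> L n" "Y1 \<in> G (n + 1)" "tri Y0 (sus C X) Y1"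
        using P sus_closed by blast
      obtain X0 where X0: "X0 \<in> Obj C" "isomorphic C (sus C X0) Y0"
        using tri_obj[OF T(3)] sus_essentially_surjective by blast
      obtain X1 where X1: "X1 \<in> Obj C" "isomorphic C (sus C X1) Y1"
        using tri_obj[OF T(3)] sus_essentially_surjective by blast
      \<comment> \<open>All three terms must literally be suspensions before \<Sigma> can be removed
        from the triangle.\<close>
      have "tri (sus C X0) (sus C X) (sus C X1)"
        using tri_iso[OF T(3) isomorphic_sym[OF X0(2)] isomorphic_refl isomorphic_sym[OF X1(2)]]
          X sus_closed by simp
      then have "tri X0 X X1"
        using tri_sus_iff[OF X0(1) X X1(1)] by simp
      moreover have "X0 \<in> L (n + 1)" "X1 \<in> G (n + 1 + 1)"
        using strict_iso[OF strict_L T(1) isomorphic_sym[OF X0(2)]]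
          strict_iso[OF strict_G T(2) isomorphic_sym[OF X1(2)]]
        by (simp_all only: sus_in_L_iff[OF X0(1)] sus_in_G_iff[OF X1(1)])
      ultimately show "\<exists>X0 \<in> L (n + 1). \<exists>X1 \<in> G (n + 1 + 1). tri X0 X X1"
        by blast
    qed
  qed
  moreover have "?P 0"
    using t_structure L_0 G_1 unfolding t_structure_def tri_def by simp
  ultimately have "?P n"
    using int_shift_invariant[of ?P n 0] by blast
  then show ?thesis
    using assms that by blast
qed

section \<open>Aisle and coaisle as mutual orthogonals\<close>

lemma sus_in_L: "X \<in> L n \<Longrightarrow> sus C X \<in> L n"
  using sus_in_L_iff L_mono[of n "n + 1"] strict_obj[OF strict_L] by auto

lemma desuspension_G:
  assumes "X \<in> G n"
  obtains W where "W \<in> G n" "isomorphic C X (sus C W)"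
proof -
  obtain W where W: "W \<in> Obj C" "isomorphic C (sus C W) X"
    using assms strict_obj[OF strict_G] sus_essentially_surjective by blast
  then have "sus C W \<in> G n"
    using assms strict_iso[OF strict_G] isomorphic_sym by blast
  then have "W \<in> G n"
    using W sus_in_G_iff G_antimono[of n "n + 1"] by auto
  then show ?thesis
    using that W isomorphic_sym by blast
qed

text \<open>Backward rotation, with \<open>W\<close> in the role of a desuspension of
  \<open>Z\<close>; coaisles are closed under desuspension.\<close>

lemma tri_desuspend_G:
  assumes "tri X Y Z" "Z \<in> G n"
  obtains W where "W \<in> G n" "tri W X Y"
proof -
  obtain W where W: "W \<in> G n" "isomorphic C Z (sus C W)"
    using assms(2) by (rule desuspension_G)
  have "tri X Y (sus C W)"
    using tri_iso[OF assms(1) isomorphic_refl isomorphic_refl W(2)] tri_obj[OF assms(1)] by blast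
  then show ?thesis
    using that W tri_unrotate strict_obj[OF strict_G] by blast
qed

text \<open>After rotation, the truncation \<open>X1\<close> is an extension of
  \<open>sus C X0\<close> by \<open>X\<close>. Both are orthogonal to \<open>X1\<close>, so
  \<open>X1\<close> is zero and \<open>X\<close> is isomorphic to \<open>X0\<close>.\<close>

lemma L_iff_orth: "X \<in> L n \<longleftrightarrow> X \<in> Obj C \<and> (\<forall>Y \<in> G (n + 1). orth X Y)"
proof
  assume X: "X \<in> Obj C \<and> (\<forall>Y \<in> G (n + 1). orth X Y)"
  then obtain X0 X1 where T: "X0 \<in> L n" "X1 \<in> G (n + 1)" "tri X0 X X1"
    using truncation by metis
  have "orth X1 X1"
    using orth_extension_left[OF tri_rotate[OF T(3)]] X T(2) orth_L_G[OF sus_in_L[OF T(1)]] by blast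
  then have "isomorphic C X0 X"
    using tri_zero_third T(3) by blast
  then show "X \<in> L n"
    using T(1) strict_iso[OF strict_L] by blast
qed (use orth_L_G strict_obj[OF strict_L] in blast)

text \<open>Dually, \<open>Y0\<close> lies between a desuspension of \<open>Y1\<close> and
  \<open>Y\<close>; it is orthogonal to both, hence to itself, and so it is zero.\<close>

lemma G_iff_orth: "Y \<in> G (n + 1) \<longleftrightarrow> Y \<in> Obj C \<and> (\<forall>X \<in> L n. orth X Y)"
proof
  assume Y: "Y \<in> Obj C \<and> (\<forall>X \<in> L n. orth X Y)"
  then obtain Y0 Y1 where T: "Y0 \<in> L n" "Y1 \<in> G (n + 1)" "tri Y0 Y Y1"
    using truncation by metis
  obtain W where W: "W \<in> G (n + 1)" "tri W Y0 Y"
    using tri_desuspend_G[OF T(3) T(2)] by blast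
  have "orth Y0 Y0"
    using orth_extension_right[OF W(2)] orth_L_G[OF T(1) W(1)] Y T(1) by blast
  then have "orth (sus C Y0) (sus C Y0)"
    using orth_sus_iff tri_obj[OF T(3)] by blast
  then have "isomorphic C Y Y1"
    using tri_zero_third[OF tri_rotate[OF T(3)]] by blast
  then show "Y \<in> G (n + 1)"
    using T(2) strict_iso[OF strict_G] isomorphic_sym by blast
qed (use orth_L_G strict_obj[OF strict_G] in blast)

lemma L_extension: "tri X Y Z \<Longrightarrow> X \<in> L n \<Longrightarrow> Z \<in> L n \<Longrightarrow> Y \<in> L n"
  using L_iff_orth orth_extension_left tri_obj by blast

lemma G_extension:
  assumes "tri X Y Z" "X \<in> G n" "Z \<in> G n"
  shows "Y \<in> G n"
  using assms G_iff_orth[of _ "n - 1"] orth_extension_right[OF assms(1)] tri_obj[OF assms(1)] by simp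

section \<open>Shifted hearts and induction along truncations\<close>

lemma sus_pow_heart: "sus_pow C (- j) (heart C D) = L j \<inter> G j"
proof -
  \<comment> \<open>The heart is the degree 0 member of this family.\<close>
  have "shift_family (\<lambda>n. L (- n) \<inter> G (- n))"
    using shift_family_L shift_family_G
    unfolding shift_family_def strict_full_subcategory_def by blast
  from sus_pow_eq_shift_family[OF this, of "- j"] show ?thesis
    by (simp add: heart_def)
qed

text \<open>\<open>X1\<close> sits in the rotated triangle between \<open>X\<close> and
  \<open>sus C X0\<close>, both in \<open>L (m + 1)\<close>, so it lies in the heart of degree
  \<open>m + 1\<close>.\<close>

lemma truncation_step_L:
  assumes "X \<in> L (m + 1)"
  obtains X0 X1 where "X0 \<in> L m" "X1 \<in> L (m + 1) \<inter> G (m + 1)" "tri X0 X X1"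
proof -
  obtain X0 X1 where T: "X0 \<in> L m" "X1 \<in> G (m + 1)" "tri X0 X X1"
    using assms truncation strict_obj[OF strict_L] by metis
  have "sus C X0 \<in> L (m + 1)"
    using sus_in_L[OF T(1)] L_mono[of m "m + 1"] by auto
  then have "X1 \<in> L (m + 1)"
    using L_extension[OF tri_rotate[OF T(3)] assms] by blast
  then show ?thesis
    using that T by blast
qed

lemma truncation_step_G:
  assumes "X \<in> G m"
  obtains X0 X1 where "X0 \<in> L m \<inter> G m" "X1 \<in> G (m + 1)" "tri X0 X X1"
proof -
  obtain X0 X1 where T: "X0 \<in> L m" "X1 \<in> G (m + 1)" "tri X0 X X1"
    using assms truncation strict_obj[OF strict_G] by metis
  then have "X1 \<in> G m"
    using G_antimono[of m "m + 1"] by auto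
  then obtain W where "W \<in> G m" "tri W X0 X"
    using tri_desuspend_G[OF T(3)] by blast
  then have "X0 \<in> G m"
    using G_extension assms by blast
  then show ?thesis
    using that T by blast
qed

text \<open>Upward induction from \<open>n\<close>: passing from \<open>L m\<close> to
  \<open>L (m + 1)\<close> only adds extensions by objects of the heart in degree
  \<open>m + 1\<close>. \<open>A\<close> stands for the aisle of the other t-structure.\<close>

lemma L_subset_iff_hearts:
  assumes "n \<le> m" "L n \<subseteq> A" and ext: "\<And>X Y Z. tri X Y Z \<Longrightarrow> X \<in> A \<Longrightarrow> Z \<in> A \<Longrightarrow> Y \<in> A"
  shows "L m \<subseteq> A \<longleftrightarrow> (\<forall>j \<in> {n + 1..m}. L j \<inter> G j \<subseteq> A)"
proof
  assume "L m \<subseteq> A"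
  then show "\<forall>j \<in> {n + 1..m}. L j \<inter> G j \<subseteq> A"
    using L_mono by fastforce
next
  assume "\<forall>j \<in> {n + 1..m}. L j \<inter> G j \<subseteq> A"
  with assms(1) show "L m \<subseteq> A"
  proof (induction m rule: int_ge_induct)
    case (step m)
    then have "L m \<subseteq> A" "L (m + 1) \<inter> G (m + 1) \<subseteq> A"
      by auto
    show ?case
    proof
      fix X assume "X \<in> L (m + 1)"
      then show "X \<in> A"
        by (rule truncation_step_L) (use \<open>L m \<subseteq> A\<close> \<open>L (m + 1) \<inter> G (m + 1) \<subseteq> A\<close> ext in blast)
    qed
  qed (use assms(2) in simp)
qed

text \<open>The dual induction runs downwards from \<open>G (n + 1)\<close>, adding one shifted
  heart in each step.\<close>

lemma G_subset_iff_hearts: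
  assumes "m \<le> n" "G (n + 1) \<subseteq> A" and ext: "\<And>X Y Z. tri X Y Z \<Longrightarrow> X \<in> A \<Longrightarrow> Z \<in> A \<Longrightarrow> Y \<in> A"
  shows "G (m + 1) \<subseteq> A \<longleftrightarrow> (\<forall>j \<in> {m + 1..n}. L j \<inter> G j \<subseteq> A)"
proof
  assume "G (m + 1) \<subseteq> A"
  then show "\<forall>j \<in> {m + 1..n}. L j \<inter> G j \<subseteq> A"
    using G_antimono by fastforce
next
  assume "\<forall>j \<in> {m + 1..n}. L j \<inter> G j \<subseteq> A"
  with assms(1) show "G (m + 1) \<subseteq> A"
  proof (induction m rule: int_le_induct)
    case (step m)
    then have "G (m + 1) \<subseteq> A" "L m \<inter> G m \<subseteq> A"
      by auto
    have "G m \<subseteq> A"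
    proof
      fix X assume "X \<in> G m"
      then show "X \<in> A"
        by (rule truncation_step_G) (use \<open>G (m + 1) \<subseteq> A\<close> \<open>L m \<inter> G m \<subseteq> A\<close> ext in blast)
    qed
    then show ?case by simp
  qed (use assms(2) in simp)
qed

section \<open>Comparison of aisles\<close>

lemma L_subset_imp_le:
  assumes "\<not> stable_t_structure C D" "L n \<subseteq> L m"
  shows "n \<le> m"
proof (rule ccontr)
  assume "\<not> n \<le> m"
  then have "L n \<subseteq> L (n - 1)"
    using assms(2) L_mono[of m "n - 1"] by auto
  \<comment> \<open>One inclusion against the order of degrees, moved to degree 0, already makes the
    t-structure stable.\<close>
  then have "L 0 \<subseteq> L (- 1)"
    using L_subset_shift[of 0 n "- 1"] by simp
  then have "sus_pow C 1 (fst D) = fst D"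
    using L_mono[of "- 1" 0] L_0 unfolding t_le_def by auto
  then show False
    using assms(1) t_structure unfolding stable_t_structure_def by blast
qed

end

text \<open>Passing to orthogonals reverses inclusions, and each half of a t-structure is the
  orthogonal of the other.\<close>

lemma (in triangulated_category) t_le_subset_iff_t_ge_subset:
  assumes "t_structure C D" "t_structure C E"
  shows "t_le C E n \<subseteq> t_le C D m \<longleftrightarrow> t_ge C D (m + 1) \<subseteq> t_ge C E (n + 1)"
proof -
  interpret D: t_structured_category C D
    by unfold_locales (rule assms)
  interpret E: t_structured_category C E
    by unfold_locales (rule assms)
  show ?thesis
    using D.L_iff_orth[of _ m] E.G_iff_orth[of _ n] D.orth_L_G E.orth_L_G
      strict_obj[OF E.strict_L] strict_obj[OF D.strict_G] by blast
qed

section \<open>The distance\<close>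

theorem theorem2:
  fixes C :: "('o, 'm, 'z) triangulated_data_scheme"
    and D1 D2 :: "'o set \<times> 'o set"
    and n1 n2 a b :: int
    and U_le0 U_ge1 :: "'o set"
    and A B :: "int set"
  assumes "triangulated_category C"
    and "t_structure C D1" and "t_structure C D2"
    and "\<not> stable_t_structure C D1" and "\<not> stable_t_structure C D2"
    and "n1 \<le> n2"
    and "t_le C D1 n1 \<subseteq> t_le C D2 0" and "t_le C D2 0 \<subseteq> t_le C D1 n2"
    and "U_le0 = t_ge C D1 (n1 + 1) \<inter> t_le C D1 n2 \<inter> t_le C D2 0"
    and "U_ge1 = t_ge C D1 (n1 + 1) \<inter> t_le C D1 n2 \<inter> t_ge C D2 1"
    and "A = {i \<in> {n1 + 1..n2}. \<forall>j \<in> {n1 + 1..i}. sus_pow C (- j) (heart C D1) \<subseteq> U_le0}"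
    and "a = (if A \<noteq> {} then Max A else n1)"
    and "B = {i \<in> {n1 + 1..n2}. \<forall>j \<in> {i..n2}. sus_pow C (- j) (heart C D1) \<subseteq> U_ge1}"
    and "b = (if B \<noteq> {} then Min B else n2 + 1)"
  shows "\<exists>d::nat. t_distance C D1 D2 = enat d \<and> int d = b - a - 1"
proof -
  interpret T1: t_structured_category C D1
    by (intro t_structured_category.intro t_structured_category_axioms.intro assms)
  interpret T2: t_structured_category C D2
    by (intro t_structured_category.intro t_structured_category_axioms.intro assms)
  have dual: "t_le C D2 0 \<subseteq> t_le C D1 m \<longleftrightarrow> t_ge C D1 (m + 1) \<subseteq> t_ge C D2 1" for m
    using T1.t_le_subset_iff_t_ge_subset[of D1 D2 0 m] assms(2,3) by simp
  \<comment> \<open>For hearts in this range the bounds from \<open>D1\<close> in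
    \<open>U_le0\<close> and \<open>U_ge1\<close> hold automatically; only the condition from
    \<open>D2\<close> remains.\<close>
  have heart_bounds: "t_le C D1 j \<inter> t_ge C D1 j \<subseteq> t_ge C D1 (n1 + 1) \<inter> t_le C D1 n2"
    if "j \<in> {n1 + 1..n2}" for j
    using that T1.L_mono[of j n2] T1.G_antimono[of "n1 + 1" j] by auto
  have A: "A = {i \<in> {n1 + 1..n2}. t_le C D1 i \<subseteq> t_le C D2 0}"
  proof -
    have "(\<forall>j \<in> {n1 + 1..i}. sus_pow C (- j) (heart C D1) \<subseteq> U_le0) \<longleftrightarrow> t_le C D1 i \<subseteq> t_le C D2 0"
      if i: "i \<in> {n1 + 1..n2}" for i
    proof -
      have "sus_pow C (- j) (heart C D1) \<subseteq> U_le0 \<longleftrightarrow> t_le C D1 j \<inter> t_ge C D1 j \<subseteq> t_le C D2 0"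
        if "j \<in> {n1 + 1..i}" for j
        using that i heart_bounds[of j] unfolding T1.sus_pow_heart assms(9) by auto
      then show ?thesis
        using T1.L_subset_iff_hearts[OF _ assms(7) T2.L_extension, of i] i by auto
    qed
    then show ?thesis
      unfolding assms(11) by blast
  qed
  \<comment> \<open>The hearts from \<open>i\<close> to \<open>n2\<close> build up the coaisle
    \<open>t_ge C D1 i\<close>, whose aisle has degree \<open>i - 1\<close>.\<close>
  have B: "B = {i \<in> {n1 + 1..n2}. t_le C D2 0 \<subseteq> t_le C D1 (i - 1)}"
  proof -
    have "(\<forall>j \<in> {i..n2}. sus_pow C (- j) (heart C D1) \<subseteq> U_ge1) \<longleftrightarrow> t_le C D2 0 \<subseteq> t_le C D1 (i - 1)"
      if i: "i \<in> {n1 + 1..n2}" for i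
    proof -
      have "sus_pow C (- j) (heart C D1) \<subseteq> U_ge1 \<longleftrightarrow> t_le C D1 j \<inter> t_ge C D1 j \<subseteq> t_ge C D2 1"
        if "j \<in> {i..n2}" for j
        using that i heart_bounds[of j] unfolding T1.sus_pow_heart assms(10) by auto
      moreover have "t_ge C D1 (n2 + 1) \<subseteq> t_ge C D2 1"
        using dual assms(8) by blast
      ultimately show ?thesis
        using T1.G_subset_iff_hearts[OF _ _ T2.G_extension, of "i - 1" n2] i dual[of "i - 1"] by auto
    qed
    then show ?thesis
      unfolding assms(13) by blast
  qed
  have fin: "finite A" "finite B"
    unfolding A B by (rule finite_subset[of _ "{n1 + 1..n2}"]; blast intro: finite_atLeastAtMost_int)+
  have a: "t_le C D1 a \<subseteq> t_le C D2 0" "n1 \<le> a"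
  proof -
    \<comment> \<open>The default \<open>n1\<close> has the inclusion by hypothesis, just as
      \<open>n2 + 1\<close> does for \<open>b\<close>.\<close>
    have "a = n1 \<or> a \<in> A"
      using Max_in[OF fin(1)] assms(12) by simp
    then show "t_le C D1 a \<subseteq> t_le C D2 0" "n1 \<le> a"
      using A assms(7) by auto
  qed
  have b: "t_le C D2 0 \<subseteq> t_le C D1 (b - 1)" "b - 1 \<le> n2"
  proof -
    have "b = n2 + 1 \<or> b \<in> B"
      using Min_in[OF fin(2)] assms(14) by simp
    then show "t_le C D2 0 \<subseteq> t_le C D1 (b - 1)" "b - 1 \<le> n2"
      using B assms(8) by auto
  qed
  have a_max: "m \<le> a" if m: "t_le C D1 m \<subseteq> t_le C D2 0" for m
  proof -
    \<comment> \<open>Instability of \<open>D1\<close>, applied through \<open>t_le C D2 0\<close>,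
      keeps \<open>m\<close> within the range over which \<open>A\<close> is formed.\<close>
    have "m \<le> n2"
      using T1.L_subset_imp_le[OF assms(4)] m assms(8) by blast
    then have "m \<in> A" if "m > n1"
      using that m A by simp
    then show ?thesis
      using Max_ge[OF fin(1), of m] a(2) assms(12) by (cases "m > n1") auto
  qed
  have b_min: "b - 1 \<le> m" if m: "t_le C D2 0 \<subseteq> t_le C D1 m" for m
  proof -
    have "n1 \<le> m"
      using T1.L_subset_imp_le[OF assms(4)] m assms(7) by blast
    \<comment> \<open>If \<open>m \<ge> n2\<close> instead, the bound \<open>b - 1 \<le> n2\<close>
      already suffices.\<close>
    then have "m + 1 \<in> B" if "m < n2"
      using that m B by simp
    then show ?thesis
      using Min_le[OF fin(2), of "m + 1"] b(2) assms(14) by (cases "m < n2") auto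
  qed
  have ab: "a \<le> b - 1"
    using T1.L_subset_imp_le[OF assms(4)] a b by blast
  define d where "d = nat (b - a - 1)"
  have d: "int d = b - a - 1"
    using ab unfolding d_def by simp
  \<comment> \<open>The witness is \<open>a\<close>, and \<open>a + int d\<close> is
    \<open>b - 1\<close>.\<close>
  have within: "within_t_distance C D1 D2 d"
    unfolding within_t_distance_def using a b d by (intro exI[of _ a]) simp
  have least: "d \<le> e" if e: "within_t_distance C D1 D2 e" for e
  proof -
    obtain m where "t_le C D1 m \<subseteq> t_le C D2 0" "t_le C D2 0 \<subseteq> t_le C D1 (m + int e)"
      using e unfolding within_t_distance_def by blast
    then have "m \<le> a" "b - 1 \<le> m + int e"
      using a_max b_min by blast+
    then show ?thesis
      using d by linarith
  qed
  have "(LEAST d. within_t_distance C D1 D2 d) = d"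
    using within least by (rule Least_equality)
  then have "t_distance C D1 D2 = enat d"
    using within unfolding t_distance_def by auto
  then show ?thesis
    using d by blast
qed

end
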